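(* For every $t\in(0,1/2)$, $$\Gamma(t)\ \ge\ \hat\Gamma(t):=\sup_{\alpha\in[0,1]}\ \inf_{P_{pq}}\ \frac{g(P_{pq},\alpha)}{\mathbb E h(p)},$$ where the infimum is taken over all distributions $P_{pq}$ on $[0,1]^2$ with $\mathbb E h(p)>0$ of the form $(1-\beta)Q_{a_1,a_2}+\beta Q_{b_1,b_2}$ with $a_1,a_2,b_1,b_2\in[0,1]$ such that $$0\le a:=\frac{a_1+a_2}{2}\le t<b:=\frac{b_1+b_2}{2}\le 1,$$ and with $\beta=0$ or $\beta=\frac{t-a}{b-a}>0$. Here $\mathbb E h(p)$ is computed under the first marginal $P_p$ of $P_{pq}$.
   Context: Binary entropy: $h(a)=-a\log_2 a-(1-a)\log_2(1-a)$ for $a\in[0,1]$ (with $0\log_2 0=0$). Symmetric distributions and couplings: $Q_{x,y}:=\frac12\delta_{(x,y)}+\frac12\delta_{(y,x)}$, where $\delta_{(x,y)}$ is the Dirac measure at $(x,y)$. For a finitely supported distribution $P_p$ on $[0,1]$, $\mathcal C_{\mathrm s}(P_p)$ is the set of joint distributions $P_{pq}$ both of whose marginals equal $P_p$ and which satisfy $P_{pq}(x,y)=P_{pq}(y,x)$ for all $x,y$. Maximal correlation: for a pair of random variables $(X,Y)$, $$\rho_{\mathrm m}(X;Y)=\sup_{f,g}\rho_{\mathrm p}(f(X);g(Y)),$$ the supremum being over all pairs of real-valued functions $f,g$ with $\mathrm{Var}(f(X))\mathrm{Var}(g(Y))<\infty$, where $\rho_{\mathrm p}(U;V)=\frac{\mathrm{Cov}(U,V)}{\sqrt{\mathrm{Var}(U)\mathrm{Var}(V)}}$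 if $\mathrm{Var}(U)\mathrm{Var}(V)>0$ and $\rho_{\mathrm p}(U;V)=0$ if $\mathrm{Var}(U)\mathrm{Var}(V)=0$. The function $\varphi$: for $p,q,\rho\in[0,1]$ let $z_1:=pq-\rho\sqrt{p(1-p)q(1-q)}$, $z_2:=pq+\rho\sqrt{p(1-p)q(1-q)}$, and $$\varphi(\rho,p,q):=\mathrm{median}\left\{\max\{p,q,p+q-z_2\},\ 1/2,\ \min\{p+q,p+q-z_1\}\right\},$$ where the median is of the three listed numbers regarded as a multiset (so $\mathrm{median}\{a,a,b\}=a$). In particular $\varphi(0,p,q)$ is replaced in $g$ below by $p+q-pq$, and $\varphi(1,p,q)=\mathrm{median}\{\max\{p,q\},1/2,p+q\}$. The function $\Gamma$: for $t>0$, $$\Gamma(t):=\sup_{P_\rho}\ \inf_{P_p:\ \mathbb E h(p)>0,\ \mathbb E p\le t}\ \mathbb E_{\rho\sim P_\rho}\left[\inf_{P_{pq}\in\mathcal C_{\mathrm s}(P_p):\ \rho_{\mathrm m}(p;q)\le\rho}\frac{\mathbb E_{(p,q)\sim P_{pq}}h(\varphi(\rho,p,q))}{\mathbb E h(p)}\right],$$ where the supremum over $P_\rho$ and the outer infimum over $P_p$ are both taken over all finitely supported probability distributions on $[0,1]$ (with $p\sim P_p$ in $\mathbb E h(p)$ and $\mathbb E p$). The function $g$: for a symmetric finitely supported distribution $P_{pq}$ on $[0,1]^2$ with marginal $P_p$, and $\alpha\in[0,1]$, $$g(P_{pq},\alpha):=(1-\alpha)\,\mathbb E_{(p,q)\sim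 P_p^{\otimes 2}}h(p+q-pq)+\alpha\,\mathbb E_{(p,q)\sim P_{pq}}h(\varphi(1,p,q)),$$ where $P_p^{\otimes 2}$ is the product measure $P_p\otimes P_p$. *)

theory Defs
  imports "HOL-Probability.Probability"
begin

text \<open>Uses \<open>log 2 0 = 0\<close>, so the convention for \<open>0 log 0\<close> is built in. Only arguments in
  \<open>[0,1]\<close> are relevant.\<close>

definition bin_entropy :: "real \<Rightarrow> real" where
  "bin_entropy a = - a * log 2 a - (1 - a) * log 2 (1 - a)"

definition median3 :: "real \<Rightarrow> real \<Rightarrow> real \<Rightarrow> real" where
  "median3 x y z = sort [x, y, z] ! 1"

definition phi :: "real \<Rightarrow> real \<Rightarrow> real \<Rightarrow> real" where
  "phi \<rho> p q =
    (let z1 = p * q - \<rho> * sqrt (p * (1 - p) * q * (1 - q));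
         z2 = p * q + \<rho> * sqrt (p * (1 - p) * q * (1 - q))
     in median3 (max (max p q) (p + q - z2)) (1/2) (min (p + q) (p + q - z1)))"

definition fin_dists :: "real pmf set" where
  "fin_dists = {P. finite (set_pmf P) \<and> set_pmf P \<subseteq> {0..1}}"

definition sym_couplings :: "'a pmf \<Rightarrow> ('a \<times> 'a) pmf set" where
  "sym_couplings P = {Q. map_pmf fst Q = P \<and> map_pmf snd Q = P \<and>
                         (\<forall>x y. pmf Q (x, y) = pmf Q (y, x))}"

definition covariance :: "'w pmf \<Rightarrow> ('w \<Rightarrow> real) \<Rightarrow> ('w \<Rightarrow> real) \<Rightarrow> real" where
  "covariance M U V = measure_pmf.expectation M
     (\<lambda>w. (U w - measure_pmf.expectation M U) * (V w - measure_pmf.expectation M V))"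

definition pearson :: "'w pmf \<Rightarrow> ('w \<Rightarrow> real) \<Rightarrow> ('w \<Rightarrow> real) \<Rightarrow> real" where
  "pearson M U V =
    (if measure_pmf.variance M U * measure_pmf.variance M V > 0
     then covariance M U V / sqrt (measure_pmf.variance M U * measure_pmf.variance M V)
     else 0)"

text \<open>Maximal correlation of the two coordinates of a joint distribution. Square integrability
  expresses that both variances are finite; it is automatic for finitely supported \<open>Q\<close>.
  The supremum is taken in \<open>ereal\<close>, so no boundedness side condition is involved.\<close>

definition max_corr :: "('a \<times> 'b) pmf \<Rightarrow> ereal" where
  "max_corr Q =
    (SUP (f, g) \<in> {(f, g). integrable (measure_pmf Q) (\<lambda>w. (f (fst w))\<^sup>2) \<and>
                           integrable (measure_pmf Q) (\<lambda>w. (g (snd w))\<^sup>2)}.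
       ereal (pearson Q (\<lambda>w. f (fst w)) (\<lambda>w. g (snd w))))"

text \<open>The inner infimum is over a nonempty set of nonnegative reals, see \<open>inner_inf_wf\<close> below;
  hence the real-valued \<open>INF\<close> is the true infimum.\<close>

definition inner_inf :: "real \<Rightarrow> real pmf \<Rightarrow> real" where
  "inner_inf \<rho> P =
    (INF Q \<in> {Q \<in> sym_couplings P. max_corr Q \<le> ereal \<rho>}.
       measure_pmf.expectation Q (\<lambda>(p, q). bin_entropy (phi \<rho> p q)) /
       measure_pmf.expectation P bin_entropy)"

definition Gam :: "real \<Rightarrow> ereal" where
  "Gam t =
    (SUP R \<in> fin_dists.
       INF P \<in> {P \<in> fin_dists. measure_pmf.expectation P bin_entropy > 0 \<and>
                               measure_pmf.expectation P (\<lambda>p. p) \<le> t}.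
         ereal (measure_pmf.expectation R (\<lambda>\<rho>. inner_inf \<rho> P)))"

definition g_fun :: "(real \<times> real) pmf \<Rightarrow> real \<Rightarrow> real" where
  "g_fun Q \<alpha> =
    (1 - \<alpha>) * measure_pmf.expectation (pair_pmf (map_pmf fst Q) (map_pmf fst Q))
                (\<lambda>(p, q). bin_entropy (p + q - p * q)) +
    \<alpha> * measure_pmf.expectation Q (\<lambda>(p, q). bin_entropy (phi 1 p q))"

definition sym_point :: "real \<Rightarrow> real \<Rightarrow> (real \<times> real) pmf" where
  "sym_point x y = map_pmf (\<lambda>c. if c then (x, y) else (y, x)) (bernoulli_pmf (1/2))"

text \<open>\<open>mixture \<beta> Q\<^sub>0 Q\<^sub>1\<close> is \<open>(1 - \<beta>) Q\<^sub>0 + \<beta> Q\<^sub>1\<close>, for \<open>\<beta>\<close> in \<open>[0,1]\<close>.\<close>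

definition mixture :: "real \<Rightarrow> 'a pmf \<Rightarrow> 'a pmf \<Rightarrow> 'a pmf" where
  "mixture \<beta> Q0 Q1 = bind_pmf (bernoulli_pmf \<beta>) (\<lambda>c. if c then Q1 else Q0)"

definition two_point_family :: "real \<Rightarrow> (real \<times> real) pmf set" where
  "two_point_family t =
    {mixture \<beta> (sym_point a1 a2) (sym_point b1 b2) | a1 a2 b1 b2 \<beta>.
       a1 \<in> {0..1} \<and> a2 \<in> {0..1} \<and> b1 \<in> {0..1} \<and> b2 \<in> {0..1} \<and>
       (let a = (a1 + a2) / 2; b = (b1 + b2) / 2
        in 0 \<le> a \<and> a \<le> t \<and> t < b \<and> b \<le> 1 \<and>
           (\<beta> = 0 \<or> \<beta> = (t - a) / (b - a) \<and> \<beta> > 0))}"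

definition Gam_hat :: "real \<Rightarrow> ereal" where
  "Gam_hat t =
    (SUP \<alpha> \<in> {0..1}.
       INF Q \<in> {Q \<in> two_point_family t.
                  measure_pmf.expectation (map_pmf fst Q) bin_entropy > 0}.
         ereal (g_fun Q \<alpha> / measure_pmf.expectation (map_pmf fst Q) bin_entropy))"

lemma bin_entropy_nonneg:
  assumes "a \<in> {0..1}"
  shows "bin_entropy a \<ge> 0"
proof -
  have *: "x * log 2 x \<le> 0" if "0 \<le> x" "x \<le> 1" for x :: real
    using that by (cases "x = 0") (auto simp: mult_le_0_iff)
  show ?thesis
    using assms *[of a] *[of "1 - a"] by (simp add: bin_entropy_def)
qed

lemma median3_between:
  assumes "0 \<le> x" "x \<le> 1" "0 \<le> z"
  shows "median3 x (1/2) z \<in> {0..1}"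
  using assms by (auto simp: median3_def)

lemma phi_in_unit:
  assumes "\<rho> \<in> {0..1}" "p \<in> {0..1}" "q \<in> {0..1}"
  shows "phi \<rho> p q \<in> {0..1}"
proof -
  have 1: "0 \<le> \<rho> * sqrt (p * (1 - p) * q * (1 - q))"
    using assms by (intro mult_nonneg_nonneg) auto
  have 2: "p * q \<le> p"
    using assms by (simp add: mult_left_le)
  have 3: "0 \<le> (1 - p) * (1 - q)"
    using assms by simp
  show ?thesis
    unfolding phi_def Let_def using assms 1 2 3
    by (intro median3_between) (auto simp: algebra_simps max_def min_def)
qed

lemma pearson_pair_pmf:
  assumes "finite (set_pmf P)" "finite (set_pmf P')"
  shows "pearson (pair_pmf P P') (\<lambda>w. f (fst w)) (\<lambda>w. g (snd w)) = 0"
proof -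
  have E: "measure_pmf.expectation (pair_pmf P P') (\<lambda>w. u (fst w) * v (snd w)) =
      measure_pmf.expectation P u * measure_pmf.expectation P' v" for u v :: "_ \<Rightarrow> real"
  proof -
    have "measure_pmf.expectation (pair_pmf P P') (\<lambda>w. u (fst w) * v (snd w)) =
        (\<Sum>w\<in>set_pmf P \<times> set_pmf P'. (u (fst w) * pmf P (fst w)) * (v (snd w) * pmf P' (snd w)))"
      using assms
      by (subst integral_measure_pmf[of "set_pmf P \<times> set_pmf P'"])
        (auto simp: pmf_pair mult_ac intro!: sum.cong)
    also have "\<dots> = (\<Sum>x\<in>set_pmf P. u x * pmf P x) * (\<Sum>y\<in>set_pmf P'. v y * pmf P' y)"
      by (simp add: sum_product sum.cartesian_product case_prod_beta)
    also have "\<dots> = measure_pmf.expectation P u * measure_pmf.expectation P' v"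
      using assms by (simp add: integral_measure_pmf[of "set_pmf P"]
          integral_measure_pmf[of "set_pmf P'"] mult_ac)
    finally show ?thesis .
  qed
  have "measure_pmf.expectation P
      (\<lambda>x. f x - measure_pmf.expectation (pair_pmf P P') (\<lambda>w. f (fst w))) = 0"
    using E[of f "\<lambda>_. 1"] assms by (simp add: integrable_measure_pmf_finite)
  then have "covariance (pair_pmf P P') (\<lambda>w. f (fst w)) (\<lambda>w. g (snd w)) = 0"
    unfolding covariance_def
    using E[of "\<lambda>x. f x - measure_pmf.expectation (pair_pmf P P') (\<lambda>w. f (fst w))"
        "\<lambda>y. g y - measure_pmf.expectation (pair_pmf P P') (\<lambda>w. g (snd w))"] by simp
  then show ?thesis
    by (simp add: pearson_def)
qed

lemma inner_inf_wf:
  assumes "P \<in> fin_dists" "\<rho> \<in> {0..1}"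
  shows "{Q \<in> sym_couplings P. max_corr Q \<le> ereal \<rho>} \<noteq> {}"
    and "Q \<in> sym_couplings P \<Longrightarrow>
      measure_pmf.expectation Q (\<lambda>(p, q). bin_entropy (phi \<rho> p q)) /
      measure_pmf.expectation P bin_entropy \<ge> 0"
proof -
  have "max_corr (pair_pmf P P) \<le> ereal \<rho>"
    using assms unfolding max_corr_def
    by (intro SUP_least) (auto simp: pearson_pair_pmf fin_dists_def)
  moreover have "pair_pmf P P \<in> sym_couplings P"
    by (simp add: sym_couplings_def map_fst_pair_pmf map_snd_pair_pmf pmf_pair)
  ultimately show "{Q \<in> sym_couplings P. max_corr Q \<le> ereal \<rho>} \<noteq> {}"
    by blast
next
  assume Q: "Q \<in> sym_couplings P"
  have unit: "p \<in> {0..1}" "q \<in> {0..1}" if "(p, q) \<in> set_pmf Q" for p q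
  proof -
    from Q have "set_pmf P = fst ` set_pmf Q" "set_pmf P = snd ` set_pmf Q"
      unfolding sym_couplings_def by (metis (mono_tags, lifting) mem_Collect_eq set_map_pmf)+
    then have "p \<in> set_pmf P" "q \<in> set_pmf P"
      using that by force+
    then show "p \<in> {0..1}" "q \<in> {0..1}"
      using assms by (auto simp: fin_dists_def)
  qed
  have "measure_pmf.expectation Q (\<lambda>(p, q). bin_entropy (phi \<rho> p q)) \<ge> 0"
    using unit assms
    by (intro integral_nonneg_AE) (auto simp: AE_measure_pmf_iff intro!: bin_entropy_nonneg phi_in_unit
        simp del: atLeastAtMost_iff)
  moreover have "measure_pmf.expectation P bin_entropy \<ge> 0"
    using assms
    by (intro integral_nonneg_AE) (auto simp: AE_measure_pmf_iff fin_dists_def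
        intro!: bin_entropy_nonneg simp del: atLeastAtMost_iff)
  ultimately show "measure_pmf.expectation Q (\<lambda>(p, q). bin_entropy (phi \<rho> p q)) /
      measure_pmf.expectation P bin_entropy \<ge> 0"
    by simp
qed

end

theory Submission
  imports Defs
begin

text \<open>
  Let the random correlation level \<open>\<rho>\<close> be \<open>1\<close> with probability \<open>\<alpha>\<close> and \<open>0\<close> otherwise. Maximal
  correlation \<open>0\<close> means independence (\<open>max_corr_nonpos_imp_independent\<close>), and dropping the correlation
  constraint at \<open>\<rho> = 1\<close> only lowers the infimum. So \<open>Gam t\<close> is at least the infimum of
  \<open>g_fun Q \<alpha>\<close> divided by the entropy of the marginal, over \<^emph>\<open>all\<close> symmetric \<open>Q\<close> of mean at most
  \<open>t\<close> (\<open>Gam_ge_if_couplings_ge\<close>). It remains to see that a lower bound valid on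
  the two-point family holds for all of these.

  First, the mean may be taken to equal \<open>t\<close>. Shrinking \<open>Q\<close> by a factor \<open>1 - s\<close> and putting the lost
  mass on \<open>(1, 1)\<close>, where all entropies vanish, raises the mean, scales the denominator and the coupled
  part of \<open>g_fun\<close> by \<open>1 - s\<close>, and the independent part by \<open>(1 - s)\<^sup>2\<close>; the ratio cannot
  increase (\<open>g_fun_ge_of_mean_le\<close>).

  Second, at a fixed mean \<open>g_fun\<close> is concave in \<open>Q\<close>. Its coupled part is linear. For the independent
  part, put \<open>x = 1 - p\<close> and \<open>y = 1 - q\<close>. Measured in nats, the entropy of \<open>x y\<close> is
  \<open>x y - x y ln x - x y ln y\<close> minus the sum over \<open>k \<ge> 2\<close> of \<open>x\<^sup>k y\<^sup>k / (k (k - 1))\<close>. Averaged over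
  independent \<open>x\<close> and \<open>y\<close> of a common law with fixed mean, the first three terms become affine in the
  law and the series becomes a weighted sum of squares of moments (\<open>union_entropy_concave\<close>).

  Finally, a symmetric distribution of mean \<open>t\<close> is a mixture of members of the two-point family of
  mean \<open>t\<close> (\<open>two_point_decomposition\<close>), so concavity transfers a bound valid on the family to
  every such distribution (\<open>g_fun_ge_of_mean_eq\<close>).
\<close>

section \<open>Finitely supported distributions\<close>

lemma expectation_pair_pmf_finite:
  fixes k :: "'a \<times> 'b \<Rightarrow> real"
  assumes "finite (set_pmf P)" "finite (set_pmf Q)"
  shows "measure_pmf.expectation (pair_pmf P Q) k =
    (\<Sum>p\<in>set_pmf P. \<Sum>q\<in>set_pmf Q. pmf P p * pmf Q q * k (p, q))"
proof -
  have "measure_pmf.expectation (pair_pmf P Q) k =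
      (\<Sum>w\<in>set_pmf P \<times> set_pmf Q. pmf (pair_pmf P Q) w * k w)"
    using assms by (subst integral_measure_pmf[of "set_pmf P \<times> set_pmf Q"]) auto
  then show ?thesis
    by (auto simp: sum.cartesian_product pmf_pair intro!: sum.cong)
qed

lemma expectation_pmf_finite:
  fixes k :: "'a \<Rightarrow> real"
  assumes "finite (set_pmf P)"
  shows "measure_pmf.expectation P k = (\<Sum>p\<in>set_pmf P. pmf P p * k p)"
  using assms by (subst integral_measure_pmf[of "set_pmf P"]) auto

lemma set_pmf_subset_marginals:
  "set_pmf Q \<subseteq> set_pmf (map_pmf fst Q) \<times> set_pmf (map_pmf snd Q)"
  by force

lemma expectation_mixture:
  fixes f :: "'a \<Rightarrow> real"
  assumes "\<beta> \<in> {0..1}" "finite (set_pmf Q0)" "finite (set_pmf Q1)"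
  shows "measure_pmf.expectation (mixture \<beta> Q0 Q1) f =
    (1 - \<beta>) * measure_pmf.expectation Q0 f + \<beta> * measure_pmf.expectation Q1 f"
  unfolding mixture_def
  by (subst pmf_expectation_bind[of UNIV]) (use assms in \<open>auto simp: UNIV_bool\<close>)

lemma set_pmf_mixture_subset: "set_pmf (mixture \<beta> Q0 Q1) \<subseteq> set_pmf Q0 \<union> set_pmf Q1"
  by (auto simp: mixture_def split: if_splits)

lemma set_pmf_sym_point_subset: "set_pmf (sym_point x y) \<subseteq> {(x, y), (y, x)}"
  by (auto simp: sym_point_def split: if_splits)

lemma set_pmf_two_point_subset:
  "set_pmf (mixture \<beta> (sym_point a1 a2) (sym_point b1 b2)) \<subseteq> {(a1, a2), (a2, a1), (b1, b2), (b2, b1)}"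
  by (auto simp: mixture_def sym_point_def split: if_splits)

lemma expectation_sym_point:
  fixes f :: "real \<times> real \<Rightarrow> real"
  shows "measure_pmf.expectation (sym_point x y) f = (f (x, y) + f (y, x)) / 2"
  by (simp add: sym_point_def)

lemma map_pmf_mixture: "map_pmf f (mixture s Q0 Q1) = mixture s (map_pmf f Q0) (map_pmf f Q1)"
  by (simp add: mixture_def map_bind_pmf if_distrib cong: if_cong)

section \<open>Concavity of the entropy of a union of independent bits\<close>

lemma one_minus_ln_power_series:
  fixes z :: real
  assumes "0 \<le> z" "z \<le> 1"
  shows "(\<lambda>n. z ^ (n + 2) / (real (n + 1) * real (n + 2))) sums (z + (1 - z) * ln (1 - z))"
proof (cases "z = 1")
  case True
  have "(\<lambda>n. 1 / real (n + 1) - 1 / real (Suc n + 1)) sums (1 / real (0 + 1) - 0)"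
    by (rule telescope_sums') real_asymp
  moreover have "1 / real (n + 1) - 1 / real (Suc n + 1) = 1 / (real (n + 1) * real (n + 2))" for n
    by (simp add: field_simps)
  ultimately show ?thesis
    using True by simp
next
  case False
  then have z: "\<bar>z\<bar> < 1"
    using assms by simp
  have "(\<lambda>n. - (z ^ n) / real n) sums ln (1 - z)"
    using ln_series'[of "- z"] z by simp
  then have L: "(\<lambda>n. - (z ^ (n + 1)) / real (n + 1)) sums ln (1 - z)"
    using sums_Suc_iff[of "\<lambda>n. - (z ^ n) / real n" "ln (1 - z)"] by simp
  have L': "(\<lambda>n. - (z ^ (n + 2)) / real (n + 2)) sums (ln (1 - z) + z)"
    using L sums_Suc_iff[of "\<lambda>n. - (z ^ (n + 1)) / real (n + 1)" "ln (1 - z) + z"] by simp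
  have "(\<lambda>n. - (z ^ (n + 2)) / real (n + 2) - z * (- (z ^ (n + 1)) / real (n + 1)))
      sums (ln (1 - z) + z - z * ln (1 - z))"
    by (intro sums_diff L' sums_mult L)
  moreover have "- (z ^ (n + 2)) / real (n + 2) - z * (- (z ^ (n + 1)) / real (n + 1)) =
      z ^ (n + 2) / (real (n + 1) * real (n + 2))" for n
    by (simp add: field_simps)
  ultimately show ?thesis
    by (simp add: algebra_simps)
qed

text \<open>With \<open>x = 1 - p\<close> and \<open>y = 1 - q\<close> the kernel is the binary entropy of \<open>x y\<close>. Since
  \<open>ln (x y) = ln x + ln y\<close>, everything but a series of products \<open>x\<^sup>k y\<^sup>k\<close> with one fixed sign is a sum
  of terms that depend on one of \<open>x\<close>, \<open>y\<close> only linearly. This separation is what makes the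
  concavity below visible.\<close>

lemma union_entropy_kernel_sums:
  fixes p q :: real
  assumes "p \<in> {0..1}" "q \<in> {0..1}"
  shows "(\<lambda>n. ((1 - p) ^ (n + 2) * (1 - q) ^ (n + 2)) / (real (n + 1) * real (n + 2))) sums
    ((1 - p) * (1 - q) + (1 - q) * (- (1 - p) * ln (1 - p)) + (1 - p) * (- (1 - q) * ln (1 - q))
      - ln 2 * bin_entropy (p + q - p * q))"
proof -
  define x y where "x = 1 - p" and "y = 1 - q"
  have xy: "0 \<le> x" "x \<le> 1" "0 \<le> y" "y \<le> 1"
    using assms by (auto simp: x_def y_def)
  have "x * y * ln (x * y) = y * (x * ln x) + x * (y * ln y)"
    using xy by (cases "x = 0 \<or> y = 0") (auto simp: ln_mult algebra_simps)
  moreover have "ln 2 * bin_entropy (p + q - p * q) =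
      - (1 - x * y) * ln (1 - x * y) - x * y * ln (x * y)"
    by (simp add: bin_entropy_def log_def x_def y_def field_simps)
  ultimately have closed: "x * y + (1 - x * y) * ln (1 - x * y) =
      x * y + y * (- x * ln x) + x * (- y * ln y) - ln 2 * bin_entropy (p + q - p * q)"
    by (simp add: algebra_simps)
  have "0 \<le> x * y" "x * y \<le> 1"
    using xy by (auto intro: mult_le_one)
  then show ?thesis
    using one_minus_ln_power_series[of "x * y"]
    unfolding closed unfolding x_def y_def power_mult_distrib by blast
qed

text \<open>If independent bits are \<open>1\<close> with random probabilities \<open>p\<close> and \<open>q\<close> of law \<open>P\<close>, this is the
  entropy of their disjunction conditionally on \<open>p\<close> and \<open>q\<close>.\<close>

definition union_entropy :: "real pmf \<Rightarrow> real" where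
  "union_entropy P = measure_pmf.expectation (pair_pmf P P) (\<lambda>(p, q). bin_entropy (p + q - p * q))"

text \<open>Averaging the kernel expansion over \<open>p\<close> and \<open>q\<close> factorises every term. For a fixed mean
  of \<open>P\<close> the value of the series is therefore affine in \<open>P\<close> minus a multiple of the union entropy,
  while its terms are squares of linear functionals of \<open>P\<close>.\<close>

lemma union_entropy_sums:
  assumes "P \<in> fin_dists"
  defines "E \<equiv> measure_pmf.expectation P"
  shows "(\<lambda>n. (E (\<lambda>p. (1 - p) ^ (n + 2)))\<^sup>2 / (real (n + 1) * real (n + 2))) sums
    ((E (\<lambda>p. 1 - p))\<^sup>2 + 2 * E (\<lambda>p. 1 - p) * E (\<lambda>p. - (1 - p) * ln (1 - p))
      - ln 2 * union_entropy P)"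
proof -
  define S where "S = set_pmf P"
  define w where "w = pmf P"
  have fin: "finite S" and unit: "p \<in> S \<Longrightarrow> p \<in> {0..1}" for p
    using assms by (auto simp: fin_dists_def S_def)
  have E: "E k = (\<Sum>p\<in>S. w p * k p)" for k
    using fin unfolding E_def S_def w_def by (rule expectation_pmf_finite)
  have EE: "(\<Sum>p\<in>S. \<Sum>q\<in>S. w p * w q * (u p * v q)) = E u * E v" for u v
    unfolding E sum_product by (simp add: mult_ac)
  have "(\<lambda>n. \<Sum>p\<in>S. \<Sum>q\<in>S. w p * w q *
      (((1 - p) ^ (n + 2) * (1 - q) ^ (n + 2)) / (real (n + 1) * real (n + 2)))) sums
    (\<Sum>p\<in>S. \<Sum>q\<in>S. w p * w q *
      ((1 - p) * (1 - q) + (1 - q) * (- (1 - p) * ln (1 - p)) + (1 - p) * (- (1 - q) * ln (1 - q))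
      - ln 2 * bin_entropy (p + q - p * q)))"
    by (intro sums_sum sums_mult union_entropy_kernel_sums unit)
  moreover have "(\<Sum>p\<in>S. \<Sum>q\<in>S. w p * w q *
      (((1 - p) ^ (n + 2) * (1 - q) ^ (n + 2)) / (real (n + 1) * real (n + 2)))) =
      (E (\<lambda>p. (1 - p) ^ (n + 2)))\<^sup>2 / (real (n + 1) * real (n + 2))" for n
    unfolding times_divide_eq_right sum_divide_distrib[symmetric] EE power2_eq_square ..
  moreover have "(\<Sum>p\<in>S. \<Sum>q\<in>S. w p * w q *
      ((1 - p) * (1 - q) + (1 - q) * (- (1 - p) * ln (1 - p)) + (1 - p) * (- (1 - q) * ln (1 - q))
      - ln 2 * bin_entropy (p + q - p * q))) =
      (E (\<lambda>p. 1 - p))\<^sup>2 + 2 * E (\<lambda>p. 1 - p) * E (\<lambda>p. - (1 - p) * ln (1 - p))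
      - ln 2 * union_entropy P" (is "?l = _")
  proof -
    have "?l = (\<Sum>p\<in>S. \<Sum>q\<in>S. w p * w q * ((1 - p) * (1 - q)))
      + (\<Sum>p\<in>S. \<Sum>q\<in>S. w p * w q * ((- (1 - p) * ln (1 - p)) * (1 - q)))
      + (\<Sum>p\<in>S. \<Sum>q\<in>S. w p * w q * ((1 - p) * (- (1 - q) * ln (1 - q))))
      - ln 2 * (\<Sum>p\<in>S. \<Sum>q\<in>S. w p * w q * bin_entropy (p + q - p * q))"
      unfolding sum_distrib_left sum.distrib[symmetric] sum_subtractf[symmetric]
      by (intro sum.cong refl) (simp add: algebra_simps)
    moreover have "union_entropy P = (\<Sum>p\<in>S. \<Sum>q\<in>S. w p * w q * bin_entropy (p + q - p * q))"
      using fin unfolding union_entropy_def S_def w_def by (simp add: expectation_pair_pmf_finite)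
    ultimately show ?thesis
      unfolding EE by (simp add: power2_eq_square algebra_simps)
  qed
  ultimately show ?thesis
    by simp
qed

text \<open>The union entropy is a quadratic functional of the distribution and is not concave in general;
  it becomes concave among distributions of a common mean, because the term that is bilinear in the
  mean and \<open>- (1 - p) ln (1 - p)\<close> is then affine, and Jensen's inequality applies to each square
  \<open>(E (1 - p)\<^sup>k)\<^sup>2\<close>, which enters with a negative sign.\<close>

lemma union_entropy_concave:
  fixes c :: "'j \<Rightarrow> real" and R :: "'j \<Rightarrow> real pmf"
  assumes "finite J" and c: "\<And>j. j \<in> J \<Longrightarrow> c j \<ge> 0"
    and P: "P \<in> fin_dists" and R: "\<And>j. j \<in> J \<Longrightarrow> R j \<in> fin_dists"
    and mix: "\<And>f. measure_pmf.expectation P f = (\<Sum>j\<in>J. c j * measure_pmf.expectation (R j) f)"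
    and mean: "\<And>j. j \<in> J \<Longrightarrow>
      measure_pmf.expectation (R j) (\<lambda>p. 1 - p) = measure_pmf.expectation P (\<lambda>p. 1 - p)"
  shows "(\<Sum>j\<in>J. c j * union_entropy (R j)) \<le> union_entropy P"
proof -
  define \<tau> where "\<tau> = measure_pmf.expectation P (\<lambda>p. 1 - p)"
  define L where "L = (\<lambda>p::real. - (1 - p) * ln (1 - p))"
  define E :: "'j \<Rightarrow> (real \<Rightarrow> real) \<Rightarrow> real"
    where "E = (\<lambda>j. measure_pmf.expectation (R j))"
  define d where "d = (\<lambda>n. real (n + 1) * real (n + 2))"
  have c1: "(\<Sum>j\<in>J. c j) = 1"
    using mix[of "\<lambda>_. 1"] by simp
  have jensen: "(\<Sum>j\<in>J. c j * m j)\<^sup>2 \<le> (\<Sum>j\<in>J. c j * (m j)\<^sup>2)" for m :: "'j \<Rightarrow> real"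
  proof -
    define s where "s = (\<Sum>j\<in>J. c j * m j)"
    have "0 \<le> (\<Sum>j\<in>J. c j * (m j - s)\<^sup>2)"
      using c by (intro sum_nonneg) auto
    also have "\<dots> = (\<Sum>j\<in>J. c j * (m j)\<^sup>2) - 2 * s * (\<Sum>j\<in>J. c j * m j) + s\<^sup>2 * (\<Sum>j\<in>J. c j)"
      unfolding sum_distrib_left sum.distrib[symmetric] sum_subtractf[symmetric]
      by (intro sum.cong refl) (simp add: power2_eq_square algebra_simps)
    finally show ?thesis
      unfolding c1 s_def[symmetric] by (simp add: power2_eq_square)
  qed
  have SP: "(\<lambda>n. (measure_pmf.expectation P (\<lambda>p. (1 - p) ^ (n + 2)))\<^sup>2 / d n) sums
      (\<tau>\<^sup>2 + 2 * \<tau> * measure_pmf.expectation P L - ln 2 * union_entropy P)"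
    using union_entropy_sums[OF P] by (simp only: \<tau>_def L_def d_def)
  have SR: "(\<lambda>n. \<Sum>j\<in>J. c j * ((E j (\<lambda>p. (1 - p) ^ (n + 2)))\<^sup>2 / d n)) sums
      (\<Sum>j\<in>J. c j * (\<tau>\<^sup>2 + 2 * \<tau> * E j L - ln 2 * union_entropy (R j)))"
  proof (intro sums_sum sums_mult)
    fix j assume "j \<in> J"
    then show "(\<lambda>n. (E j (\<lambda>p. (1 - p) ^ (n + 2)))\<^sup>2 / d n) sums
        (\<tau>\<^sup>2 + 2 * \<tau> * E j L - ln 2 * union_entropy (R j))"
      using union_entropy_sums[OF R[of j]] mean[of j] by (simp only: E_def \<tau>_def L_def d_def)
  qed
  have "\<tau>\<^sup>2 + 2 * \<tau> * measure_pmf.expectation P L - ln 2 * union_entropy P \<le>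
      (\<Sum>j\<in>J. c j * (\<tau>\<^sup>2 + 2 * \<tau> * E j L - ln 2 * union_entropy (R j)))"
  proof (rule sums_le[OF _ SP SR])
    fix n
    have "(measure_pmf.expectation P (\<lambda>p. (1 - p) ^ (n + 2)))\<^sup>2 \<le>
        (\<Sum>j\<in>J. c j * (E j (\<lambda>p. (1 - p) ^ (n + 2)))\<^sup>2)"
      unfolding mix E_def by (rule jensen)
    then have "(measure_pmf.expectation P (\<lambda>p. (1 - p) ^ (n + 2)))\<^sup>2 / d n \<le>
        (\<Sum>j\<in>J. c j * (E j (\<lambda>p. (1 - p) ^ (n + 2)))\<^sup>2) / d n"
      by (intro divide_right_mono) (auto simp: d_def)
    then show "(measure_pmf.expectation P (\<lambda>p. (1 - p) ^ (n + 2)))\<^sup>2 / d n \<le>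
        (\<Sum>j\<in>J. c j * ((E j (\<lambda>p. (1 - p) ^ (n + 2)))\<^sup>2 / d n))"
      by (simp add: sum_divide_distrib)
  qed
  also have "\<dots> = \<tau>\<^sup>2 * (\<Sum>j\<in>J. c j) + 2 * \<tau> * (\<Sum>j\<in>J. c j * E j L)
      - ln 2 * (\<Sum>j\<in>J. c j * union_entropy (R j))"
    unfolding sum_distrib_left sum.distrib[symmetric] sum_subtractf[symmetric]
    by (intro sum.cong refl) (simp add: algebra_simps)
  finally show ?thesis
    using c1 mix[of L] by (simp add: E_def)
qed

section \<open>Splitting a distribution into two-point distributions of the same mean\<close>

text \<open>Every \<open>a\<close> with value at most \<open>t\<close> is paired with every \<open>b\<close> of value above \<open>t\<close>, the pair having
  the weight \<open>w a w b (m b - m a) / D\<close>, where \<open>D\<close> is the mean excess above \<open>t\<close>. As \<open>D\<close> is also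
  the mean deficit below \<open>t\<close>, giving shares \<open>1 - \<beta>\<close> and \<open>\<beta>\<close>
  to \<open>a\<close> and \<open>b\<close> and summing over all pairs returns the original weights. The point
  \<open>b0\<close>, which may have weight \<open>0\<close>, supplies a partner when all the weight sits on the level \<open>t\<close>.\<close>

lemma two_point_decomposition:
  fixes w m :: "'a \<Rightarrow> real"
  assumes fin: "finite U" and w: "\<And>u. u \<in> U \<Longrightarrow> w u \<ge> 0" and w1: "(\<Sum>u\<in>U. w u) = 1"
    and mean: "(\<Sum>u\<in>U. w u * m u) = t" and b0: "b0 \<in> U" "m b0 > t"
    and J_def: "J = {u\<in>U. m u \<le> t} \<times> {u\<in>U. t < m u}"
    and \<beta>_def: "\<beta> = (\<lambda>a b. (t - m a) / (m b - m a))"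
  obtains c where "\<And>j. j \<in> J \<Longrightarrow> c j \<ge> 0"
    "\<And>f. (\<Sum>u\<in>U. w u * f u) = (\<Sum>(a, b)\<in>J. c (a, b) * ((1 - \<beta> a b) * f a + \<beta> a b * f b))"
proof -
  define A where "A = {u\<in>U. m u \<le> t}"
  define B where "B = {u\<in>U. t < m u}"
  have finAB: "finite A" "finite B" and U: "U = A \<union> B" "A \<inter> B = {}"
    using fin by (auto simp: A_def B_def)
  define D where "D = (\<Sum>b\<in>B. w b * (m b - t))"
  have split: "(\<Sum>u\<in>U. w u * f u) = (\<Sum>a\<in>A. w a * f a) + (\<Sum>b\<in>B. w b * f b)" for f :: "'a \<Rightarrow> real"
    unfolding U(1) by (rule sum.union_disjoint) (use finAB U in auto)
  have "(\<Sum>u\<in>U. w u * (m u - t)) = 0"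
    using mean w1 by (simp add: right_diff_distrib sum_subtractf sum_distrib_right[symmetric])
  then have D': "(\<Sum>a\<in>A. w a * (t - m a)) = D"
    unfolding split D_def by (simp add: right_diff_distrib sum_subtractf)
  have wA: "w a \<ge> 0" if "a \<in> A" for a using that w by (auto simp: A_def)
  have wB: "w b \<ge> 0" if "b \<in> B" for b using that w by (auto simp: B_def)
  have gap: "m b - m a > 0" if "a \<in> A" "b \<in> B" for a b
    using that by (auto simp: A_def B_def)
  have "D \<ge> 0"
    unfolding D_def by (intro sum_nonneg mult_nonneg_nonneg wB) (auto simp: B_def)
  show thesis
  proof (cases "D = 0")
    case True
    have B0: "w b = 0" if "b \<in> B" for b
    proof -
      have "w b * (m b - t) = 0"
        using True finAB that wB unfolding D_def
        by (subst (asm) sum_nonneg_eq_0_iff) (auto simp: B_def)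
      with that show ?thesis by (auto simp: B_def)
    qed
    have A0: "w a * (t - m a) = 0" if "a \<in> A" for a
    proof -
      have "\<forall>a\<in>A. w a * (t - m a) = 0"
        using D' True wA finAB
        by (subst sum_nonneg_eq_0_iff[symmetric]) (auto simp: A_def)
      with that show ?thesis by blast
    qed
    \<comment> \<open>All the weight lies on the level \<open>t\<close>, where \<open>\<beta> a b = 0\<close>: the partner is immaterial.\<close>
    define c where "c = (\<lambda>(a, b). if b = b0 then w a else 0)"
    show thesis
    proof (rule that[of c])
      show "c j \<ge> 0" if "j \<in> J" for j
        using that w by (auto simp: c_def J_def)
      fix f :: "'a \<Rightarrow> real"
      have "(\<Sum>(a, b)\<in>J. c (a, b) * ((1 - \<beta> a b) * f a + \<beta> a b * f b)) =
          (\<Sum>a\<in>A. \<Sum>b\<in>B. if b = b0 then w a * ((1 - \<beta> a b) * f a + \<beta> a b * f b) else 0)"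
        unfolding J_def A_def[symmetric] B_def[symmetric] sum.cartesian_product[symmetric] c_def
        by (intro sum.cong refl) auto
      also have "\<dots> = (\<Sum>a\<in>A. w a * ((1 - \<beta> a b0) * f a + \<beta> a b0 * f b0))"
        using finAB b0 by (simp add: B_def)
      also have "\<dots> = (\<Sum>a\<in>A. w a * f a)"
      proof (intro sum.cong refl)
        fix a assume "a \<in> A"
        then have "w a = 0 \<or> \<beta> a b0 = 0"
          using A0[of a] by (auto simp: \<beta>_def)
        then show "w a * ((1 - \<beta> a b0) * f a + \<beta> a b0 * f b0) = w a * f a"
          by auto
      qed
      finally show "(\<Sum>u\<in>U. w u * f u) =
          (\<Sum>(a, b)\<in>J. c (a, b) * ((1 - \<beta> a b) * f a + \<beta> a b * f b))"
        unfolding split using B0 by simp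
    qed
  next
    case False
    define c where "c = (\<lambda>(a, b). w a * w b * (m b - m a) / D)"
    show thesis
    proof (rule that[of c])
      show "c j \<ge> 0" if "j \<in> J" for j
        using that w \<open>D \<ge> 0\<close> by (auto simp: c_def J_def intro!: divide_nonneg_nonneg mult_nonneg_nonneg)
      fix f :: "'a \<Rightarrow> real"
      have "(\<Sum>(a, b)\<in>J. c (a, b) * ((1 - \<beta> a b) * f a + \<beta> a b * f b)) =
          (\<Sum>a\<in>A. \<Sum>b\<in>B. (w a * f a) * (w b * (m b - t)) / D + (w a * (t - m a)) * (w b * f b) / D)"
        unfolding J_def A_def[symmetric] B_def[symmetric] sum.cartesian_product[symmetric]
      proof (intro sum.cong refl)
        fix a b assume ab: "a \<in> A" "b \<in> B"
        have "(m b - m a) * (1 - \<beta> a b) = m b - t" "(m b - m a) * \<beta> a b = t - m a"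
          using gap[OF ab] by (auto simp: \<beta>_def field_simps)
        then have gap_f: "(m b - m a) * ((1 - \<beta> a b) * f a + \<beta> a b * f b) = (m b - t) * f a + (t - m a) * f b"
          by (metis (no_types, lifting) distrib_left mult.assoc)
        have "c (a, b) * ((1 - \<beta> a b) * f a + \<beta> a b * f b) =
            w a * w b / D * ((m b - m a) * ((1 - \<beta> a b) * f a + \<beta> a b * f b))"
          by (simp add: c_def)
        then show "c (a, b) * ((1 - \<beta> a b) * f a + \<beta> a b * f b) =
            (w a * f a) * (w b * (m b - t)) / D + (w a * (t - m a)) * (w b * f b) / D"
          unfolding gap_f by (simp add: algebra_simps add_divide_distrib diff_divide_distrib)
      qed
      also have "\<dots> = (\<Sum>a\<in>A. w a * f a) * D / D + (\<Sum>a\<in>A. w a * (t - m a)) * (\<Sum>b\<in>B. w b * f b) / D"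
        unfolding D_def sum_product by (simp add: sum.distrib sum_divide_distrib)
      also have "\<dots> = (\<Sum>u\<in>U. w u * f u)"
        unfolding D' split using False by simp
      finally show "(\<Sum>u\<in>U. w u * f u) =
          (\<Sum>(a, b)\<in>J. c (a, b) * ((1 - \<beta> a b) * f a + \<beta> a b * f b))" ..
    qed
  qed
qed

section \<open>Nonnegativity and special values\<close>

lemma union_in_unit:
  fixes p q :: real
  assumes "p \<in> {0..1}" "q \<in> {0..1}"
  shows "p + q - p * q \<in> {0..1}"
proof -
  have "p + q - p * q = 1 - (1 - p) * (1 - q)"
    by (simp add: algebra_simps)
  moreover have "0 \<le> (1 - p) * (1 - q)" "(1 - p) * (1 - q) \<le> 1"
    using assms by (auto intro: mult_le_one)
  ultimately show ?thesis
    by simp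
qed

lemma phi_0:
  assumes "p \<in> {0..1}" "q \<in> {0..1}"
  shows "phi 0 p q = p + q - p * q"
proof -
  have "0 \<le> p * (1 - q)" "0 \<le> q * (1 - p)" "0 \<le> p * q"
    using assms by auto
  then have "max (max p q) (p + q - p * q) = p + q - p * q" "min (p + q) (p + q - p * q) = p + q - p * q"
    by (auto simp: algebra_simps max_def min_def)
  then show ?thesis
    by (simp add: phi_def Let_def median3_def)
qed

lemma phi_1_1: "phi 1 1 1 = 1"
  by (simp add: phi_def median3_def)

lemma bin_entropy_1 [simp]: "bin_entropy 1 = 0"
  by (simp add: bin_entropy_def)

lemma g_fun_alt:
  "g_fun Q \<alpha> = (1 - \<alpha>) * union_entropy (map_pmf fst Q)
    + \<alpha> * measure_pmf.expectation Q (\<lambda>(p, q). bin_entropy (phi 1 p q))"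
  by (simp add: g_fun_def union_entropy_def)

lemma expectation_entropy_nonneg:
  assumes "set_pmf P \<subseteq> {0..1}"
  shows "measure_pmf.expectation P bin_entropy \<ge> 0"
  using assms by (intro integral_nonneg_AE) (auto simp: AE_measure_pmf_iff intro!: bin_entropy_nonneg)

lemma union_entropy_nonneg:
  assumes "set_pmf P \<subseteq> {0..1}"
  shows "union_entropy P \<ge> 0"
  unfolding union_entropy_def
proof (intro integral_nonneg_AE, unfold AE_measure_pmf_iff, clarsimp)
  fix p q assume "p \<in> set_pmf P" "q \<in> set_pmf P"
  then show "bin_entropy (p + q - p * q) \<ge> 0"
    using assms by (intro bin_entropy_nonneg union_in_unit) auto
qed

lemma g_fun_nonneg:
  assumes "set_pmf Q \<subseteq> {0..1} \<times> {0..1}" "\<alpha> \<in> {0..1}"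
  shows "g_fun Q \<alpha> \<ge> 0"
proof -
  have "union_entropy (map_pmf fst Q) \<ge> 0"
    using assms by (intro union_entropy_nonneg) auto
  moreover have "measure_pmf.expectation Q (\<lambda>(p, q). bin_entropy (phi 1 p q)) \<ge> 0"
  proof (intro integral_nonneg_AE, unfold AE_measure_pmf_iff, clarsimp)
    fix p q assume "(p, q) \<in> set_pmf Q"
    then show "bin_entropy (phi 1 p q) \<ge> 0"
      using assms by (intro bin_entropy_nonneg phi_in_unit) auto
  qed
  ultimately show ?thesis
    using assms by (simp add: g_fun_alt)
qed

section \<open>Random correlation level zero or one\<close>

text \<open>Testing the maximal correlation with the indicators of \<open>{x}\<close> and \<open>{y}\<close>, and again with the
  sign of the first one reversed, forces their covariance to vanish. The Pearson coefficient is \<open>0\<close>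
  by convention when an indicator is almost surely constant; there the elementary bounds on the joint
  probability already give the product.\<close>

lemma max_corr_nonpos_imp_independent:
  fixes Q :: "('a \<times> 'b) pmf"
  assumes fin: "finite (set_pmf Q)" and corr: "max_corr Q \<le> 0"
  shows "Q = pair_pmf (map_pmf fst Q) (map_pmf snd Q)"
proof (rule pmf_eqI, clarify)
  fix x y
  define E where "E = (\<lambda>f. measure_pmf.expectation Q f :: real)"
  define U where "U = (\<lambda>w::'a \<times> 'b. indicator {x} (fst w) :: real)"
  define V where "V = (\<lambda>w::'a \<times> 'b. indicator {y} (snd w) :: real)"
  define a b c where "a = E U" and "b = E V" and "c = E (\<lambda>w. U w * V w)"
  have int: "integrable (measure_pmf Q) f" for f :: "_ \<Rightarrow> real"
    using fin by (rule integrable_measure_pmf_finite)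
  have "(\<lambda>w. U w * V w) = indicator {(x, y)}"
    by (auto simp: U_def V_def indicator_def fun_eq_iff)
  then have c: "c = pmf Q (x, y)"
    by (simp add: c_def E_def pmf.rep_eq)
  have "a = measure_pmf.expectation (map_pmf fst Q) (indicator {x})"
    "b = measure_pmf.expectation (map_pmf snd Q) (indicator {y})"
    by (simp_all only: integral_map_pmf a_def b_def E_def U_def V_def)
  then have ab: "a = pmf (map_pmf fst Q) x" "b = pmf (map_pmf snd Q) y"
    by (simp_all add: measure_pmf_single)
  have mono: "E f \<le> E g" if "\<And>w. f w \<le> g w" for f g
    unfolding E_def by (intro integral_mono int that)
  have bounds: "c \<le> a" "c \<le> b" "0 \<le> c" "b - c \<le> 1 - a"
  proof -
    show "c \<le> a" "c \<le> b"
      unfolding c_def a_def b_def by (intro mono; simp add: U_def V_def indicator_def)+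
    show "0 \<le> c"
      by (simp add: c)
    have "E (\<lambda>w. V w - U w * V w) \<le> E (\<lambda>w. 1 - U w)"
      by (intro mono) (simp add: U_def V_def indicator_def)
    then show "b - c \<le> 1 - a"
      using int by (simp add: E_def a_def b_def c_def)
  qed
  have cov: "covariance Q U V = c - a * b"
  proof -
    have "covariance Q U V = E (\<lambda>w. U w * V w - a * V w - b * U w + a * b)"
      unfolding covariance_def a_def b_def E_def by (intro Bochner_Integration.integral_cong) (auto simp: algebra_simps)
    also have "\<dots> = c - a * E V - b * E U + a * b"
      using int by (simp add: E_def c_def)
    finally show ?thesis
      by (simp add: a_def b_def)
  qed
  have sq: "E (\<lambda>w. (I w - E I)\<^sup>2) = E I * (1 - E I)" if I: "\<And>w. I w = 0 \<or> I w = 1" for I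
  proof -
    have "(I w - E I)\<^sup>2 = (1 - 2 * E I) * I w + (E I)\<^sup>2" for w
      using I[of w] by (auto simp: power2_eq_square algebra_simps)
    then have "E (\<lambda>w. (I w - E I)\<^sup>2) = E (\<lambda>w. (1 - 2 * E I) * I w + (E I)\<^sup>2)"
      by simp
    also have "\<dots> = (1 - 2 * E I) * E I + (E I)\<^sup>2"
      using int unfolding E_def by simp
    finally show ?thesis
      by (simp add: power2_eq_square algebra_simps)
  qed
  have var: "measure_pmf.variance Q U = a * (1 - a)" "measure_pmf.variance Q V = b * (1 - b)"
    using sq[of U] sq[of V] by (auto simp: E_def a_def b_def U_def V_def indicator_def)
  have "c = a * b"
  proof (cases "a * (1 - a) * (b * (1 - b)) > 0")
    case True
    have "ereal (pearson Q (\<lambda>w. f (fst w)) (\<lambda>w. g (snd w))) \<le> max_corr Q" for f g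
      unfolding max_corr_def using int by (intro SUP_upper2[of "(f, g)"]) auto
    from order_trans[OF this corr]
    have pearson: "pearson Q (\<lambda>w. f (fst w)) (\<lambda>w. g (snd w)) \<le> 0" for f g
      by (simp add: zero_ereal_def)
    have "pearson Q U V \<le> 0"
      using pearson[of "indicator {x}" "indicator {y}"] by (simp only: U_def V_def)
    then have "c - a * b \<le> 0"
      using True by (simp add: pearson_def var cov divide_le_0_iff)
    moreover have "covariance Q (\<lambda>w. - U w) V = - (c - a * b)"
    proof -
      have "(- U w - measure_pmf.expectation Q (\<lambda>w. - U w)) * k =
          - ((U w - measure_pmf.expectation Q U) * k)" for w k
        by (simp add: algebra_simps)
      then show ?thesis
        unfolding cov[symmetric] covariance_def by (simp only: Bochner_Integration.integral_minus)
    qed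
    moreover have "measure_pmf.variance Q (\<lambda>w. - U w) = a * (1 - a)"
      unfolding var[symmetric] by (simp add: power2_commute)
    moreover have "pearson Q (\<lambda>w. - U w) V \<le> 0"
      using pearson[of "\<lambda>z. - indicator {x} z" "indicator {y}"] by (simp only: U_def V_def)
    ultimately show ?thesis
      using True by (simp add: pearson_def var divide_le_0_iff)
  next
    case False
    have "0 \<le> a" "a \<le> 1" "0 \<le> b" "b \<le> 1"
      by (auto simp: ab pmf_le_1)
    then have "a = 0 \<or> a = 1 \<or> b = 0 \<or> b = 1"
      using False by (metis diff_gt_0_iff_gt less_eq_real_def mult_pos_pos)
    then show ?thesis
      using bounds by auto
  qed
  then show "pmf Q (x, y) = pmf (pair_pmf (map_pmf fst Q) (map_pmf snd Q)) (x, y)"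
    by (simp add: c ab pmf_pair)
qed

lemma inner_inf_0_ge:
  assumes P: "P \<in> fin_dists"
  shows "union_entropy P / measure_pmf.expectation P bin_entropy \<le> inner_inf 0 P"
  unfolding inner_inf_def
proof (rule cINF_greatest)
  show "{Q \<in> sym_couplings P. max_corr Q \<le> ereal 0} \<noteq> {}"
    using inner_inf_wf(1)[OF P, of 0] by simp
  fix Q assume Q: "Q \<in> {Q \<in> sym_couplings P. max_corr Q \<le> ereal 0}"
  then have marg: "map_pmf fst Q = P" "map_pmf snd Q = P"
    by (auto simp: sym_couplings_def)
  have "set_pmf Q \<subseteq> set_pmf P \<times> set_pmf P"
    using set_pmf_subset_marginals[of Q] by (simp only: marg)
  then have "finite (set_pmf Q)"
    using P by (auto simp: fin_dists_def intro: finite_subset)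
  then have Q_eq: "Q = pair_pmf P P"
    using max_corr_nonpos_imp_independent[of Q] Q marg by (simp add: zero_ereal_def)
  have "measure_pmf.expectation Q (\<lambda>(p, q). bin_entropy (phi 0 p q)) = union_entropy P"
    unfolding Q_eq union_entropy_def
    using P by (intro integral_cong_AE) (auto simp: AE_measure_pmf_iff fin_dists_def phi_0 subset_iff)
  then show "union_entropy P / measure_pmf.expectation P bin_entropy
    \<le> measure_pmf.expectation Q (\<lambda>(p, q). bin_entropy (phi 0 p q)) / measure_pmf.expectation P bin_entropy"
    by simp
qed

text \<open>The law that puts mass \<open>\<alpha>\<close> on \<open>\<rho> = 1\<close> and \<open>1 - \<alpha>\<close> on \<open>\<rho> = 0\<close> is a candidate in the
  supremum. At \<open>\<rho> = 0\<close> independence is the only admissible coupling, while the infimum at \<open>\<rho> = 1\<close>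
  is bounded below by ranging over all symmetric couplings.\<close>

lemma Gam_ge_if_couplings_ge:
  assumes \<alpha>: "\<alpha> \<in> {0..1}"
    and ge: "\<And>P Q. \<lbrakk>P \<in> fin_dists; measure_pmf.expectation P bin_entropy > 0;
        measure_pmf.expectation P (\<lambda>p. p) \<le> t; Q \<in> sym_couplings P\<rbrakk>
      \<Longrightarrow> v \<le> g_fun Q \<alpha> / measure_pmf.expectation P bin_entropy"
  shows "ereal v \<le> Gam t"
proof -
  define R :: "real pmf" where "R = map_pmf (\<lambda>c. if c then 1 else 0) (bernoulli_pmf \<alpha>)"
  have "R \<in> fin_dists"
    by (auto simp: R_def fin_dists_def)
  moreover have "ereal v \<le> (INF P \<in> {P \<in> fin_dists. measure_pmf.expectation P bin_entropy > 0 \<and>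
      measure_pmf.expectation P (\<lambda>p. p) \<le> t}. ereal (measure_pmf.expectation R (\<lambda>\<rho>. inner_inf \<rho> P)))"
  proof (rule INF_greatest)
    fix P assume "P \<in> {P \<in> fin_dists. measure_pmf.expectation P bin_entropy > 0 \<and>
      measure_pmf.expectation P (\<lambda>p. p) \<le> t}"
    then have P: "P \<in> fin_dists" "measure_pmf.expectation P bin_entropy > 0"
      "measure_pmf.expectation P (\<lambda>p. p) \<le> t"
      by auto
    define H where "H = measure_pmf.expectation P bin_entropy"
    define A where "A = union_entropy P / H"
    define B where "B = (\<lambda>Q. measure_pmf.expectation Q (\<lambda>(p, q). bin_entropy (phi 1 p q)) / H)"
    have nonempty: "{Q \<in> sym_couplings P. max_corr Q \<le> ereal 1} \<noteq> {}"
      using inner_inf_wf(1)[OF P(1), of 1] by simp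
    have vB: "v \<le> (1 - \<alpha>) * A + \<alpha> * B Q" if "Q \<in> sym_couplings P" for Q
      using ge[OF P that] that
      by (simp add: g_fun_alt A_def B_def H_def sym_couplings_def add_divide_distrib)
    have "v \<le> (1 - \<alpha>) * A + \<alpha> * inner_inf 1 P"
    proof (cases "\<alpha> = 0")
      case True
      then show ?thesis
        using nonempty vB by auto
    next
      case False
      then have "\<alpha> > 0"
        using \<alpha> by auto
      have "(v - (1 - \<alpha>) * A) / \<alpha> \<le> inner_inf 1 P"
        unfolding inner_inf_def
      proof (rule cINF_greatest[OF nonempty])
        fix Q assume "Q \<in> {Q \<in> sym_couplings P. max_corr Q \<le> ereal 1}"
        then have "(v - (1 - \<alpha>) * A) / \<alpha> \<le> B Q"
          using vB[of Q] \<open>\<alpha> > 0\<close> by (simp add: field_simps)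
        then show "(v - (1 - \<alpha>) * A) / \<alpha> \<le>
            measure_pmf.expectation Q (\<lambda>(p, q). bin_entropy (phi 1 p q)) /
            measure_pmf.expectation P bin_entropy"
          by (simp add: B_def H_def)
      qed
      then show ?thesis
        using \<open>\<alpha> > 0\<close> by (simp add: field_simps)
    qed
    also have "\<dots> \<le> (1 - \<alpha>) * inner_inf 0 P + \<alpha> * inner_inf 1 P"
      using mult_left_mono[OF inner_inf_0_ge[OF P(1)], of "1 - \<alpha>"] \<alpha>
      by (simp add: A_def H_def)
    also have "\<dots> = measure_pmf.expectation R (\<lambda>\<rho>. inner_inf \<rho> P)"
      using \<alpha> by (simp add: R_def algebra_simps)
    finally show "ereal v \<le> ereal (measure_pmf.expectation R (\<lambda>\<rho>. inner_inf \<rho> P))"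
      by simp
  qed
  ultimately show ?thesis
    unfolding Gam_def by (rule SUP_upper2)
qed

section \<open>Reduction to the two-point family\<close>

text \<open>The linear form of the inequality is the one that mixtures preserve. It extends to members of
  zero entropy, for which the ratio carries no information, because \<open>g_fun\<close> is nonnegative.\<close>

lemma two_point_family_g_fun_ge:
  assumes \<alpha>: "\<alpha> \<in> {0..1}" and Q: "Q \<in> two_point_family t"
    and v: "\<And>Q. \<lbrakk>Q \<in> two_point_family t; measure_pmf.expectation (map_pmf fst Q) bin_entropy > 0\<rbrakk>
      \<Longrightarrow> v \<le> g_fun Q \<alpha> / measure_pmf.expectation (map_pmf fst Q) bin_entropy"
  shows "v * measure_pmf.expectation (map_pmf fst Q) bin_entropy \<le> g_fun Q \<alpha>"
proof -
  have unit: "set_pmf Q \<subseteq> {0..1} \<times> {0..1}"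
  proof -
    obtain a1 a2 b1 b2 \<beta> where "Q = mixture \<beta> (sym_point a1 a2) (sym_point b1 b2)"
      and "a1 \<in> {0..1}" "a2 \<in> {0..1}" "b1 \<in> {0..1}" "b2 \<in> {0..1}"
      using Q unfolding two_point_family_def mem_Collect_eq by blast
    then show ?thesis
      using set_pmf_two_point_subset[of \<beta> a1 a2 b1 b2] by auto
  qed
  then have "measure_pmf.expectation (map_pmf fst Q) bin_entropy \<ge> 0"
    by (intro expectation_entropy_nonneg) auto
  then show ?thesis
  proof (cases "measure_pmf.expectation (map_pmf fst Q) bin_entropy = 0")
    case True
    then show ?thesis
      using g_fun_nonneg[OF unit \<alpha>] by (simp del: integral_map_pmf)
  next
    case False
    with \<open>_ \<ge> 0\<close> have "measure_pmf.expectation (map_pmf fst Q) bin_entropy > 0"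
      by linarith
    with v[OF Q this] show ?thesis
      by (simp add: pos_le_divide_eq del: integral_map_pmf)
  qed
qed

text \<open>By symmetry \<open>Q\<close> is a mixture of the distributions \<open>sym_point x y\<close>, hence, splitting with respect
  to \<open>(x + y) / 2\<close>, of members of the two-point family all of which have mean \<open>t\<close>. Among these,
  \<open>g_fun\<close> minus \<open>v\<close> times the entropy is concave, so nonnegativity passes from the members to \<open>Q\<close>.\<close>

lemma g_fun_ge_of_mean_eq:
  assumes \<alpha>: "\<alpha> \<in> {0..1}" and "t < 1"
    and fin: "finite (set_pmf Q)" and unit: "set_pmf Q \<subseteq> {0..1} \<times> {0..1}"
    and sym: "map_pmf prod.swap Q = Q" and mean: "measure_pmf.expectation Q fst = t"
    and ge: "\<And>R. R \<in> two_point_family t \<Longrightarrow>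
      v * measure_pmf.expectation (map_pmf fst R) bin_entropy \<le> g_fun R \<alpha>"
  shows "v * measure_pmf.expectation (map_pmf fst Q) bin_entropy \<le> g_fun Q \<alpha>"
proof -
  \<comment> \<open>Since \<open>t < 1\<close>, the point \<open>(1, 1)\<close> guarantees a partner of mean above \<open>t\<close>.\<close>
  define U where "U = insert (1, 1) (set_pmf Q)"
  define m where "m = (\<lambda>u::real \<times> real. (fst u + snd u) / 2)"
  define \<beta> where "\<beta> = (\<lambda>a b. (t - m a) / (m b - m a))"
  define J where "J = {u\<in>U. m u \<le> t} \<times> {u\<in>U. t < m u}"
  define sym_avg where "sym_avg = (\<lambda>(f :: real \<times> real \<Rightarrow> real) u. (f u + f (prod.swap u)) / 2)"
  have finU: "finite U" and U: "U \<subseteq> {0..1} \<times> {0..1}"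
    using fin unit by (auto simp: U_def)
  then have finJ: "finite J"
    by (simp add: J_def)
  have E_U: "measure_pmf.expectation Q f = (\<Sum>u\<in>U. pmf Q u * f u)" for f :: "_ \<Rightarrow> real"
    using finU by (subst integral_measure_pmf[of U]) (auto simp: U_def)
  have E_avg: "measure_pmf.expectation Q f = (\<Sum>u\<in>U. pmf Q u * sym_avg f u)" for f
  proof -
    have "measure_pmf.expectation Q f = measure_pmf.expectation Q (\<lambda>u. f (prod.swap u))"
      by (subst sym[symmetric]) simp
    then have "measure_pmf.expectation Q f = measure_pmf.expectation Q (sym_avg f)"
      using fin by (simp add: sym_avg_def integrable_measure_pmf_finite)
    then show ?thesis
      by (simp only: E_U)
  qed
  have w1: "(\<Sum>u\<in>U. pmf Q u) = 1"
    using E_U[of "\<lambda>_. 1"] by simp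
  have mean_m: "(\<Sum>u\<in>U. pmf Q u * m u) = t"
    using E_avg[of fst] mean by (simp add: sym_avg_def m_def)
  have b0: "(1, 1) \<in> U" "m (1, 1) > t"
    using \<open>t < 1\<close> by (auto simp: U_def m_def)
  obtain c where c: "\<And>j. j \<in> J \<Longrightarrow> c j \<ge> 0" and
    decomp: "\<And>f. (\<Sum>u\<in>U. pmf Q u * f u) =
      (\<Sum>(a, b)\<in>J. c (a, b) * ((1 - \<beta> a b) * f a + \<beta> a b * f b))"
    by (rule two_point_decomposition[OF finU pmf_nonneg w1 mean_m b0 J_def \<beta>_def]) blast
  define R where "R = (\<lambda>(a, b). mixture (\<beta> a b) (sym_point (fst a) (snd a)) (sym_point (fst b) (snd b)))"
  have \<beta>: "\<beta> a b \<in> {0..1}" "(1 - \<beta> a b) * m a + \<beta> a b * m b = t" if "(a, b) \<in> J" for a b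
  proof -
    have "m a \<le> t" "t < m b"
      using that by (auto simp: J_def)
    moreover from this have "(1 - \<beta> a b) * m a + \<beta> a b * m b = m a + \<beta> a b * (m b - m a)"
      by (simp add: algebra_simps)
    ultimately show "\<beta> a b \<in> {0..1}" "(1 - \<beta> a b) * m a + \<beta> a b * m b = t"
      by (auto simp: \<beta>_def)
  qed
  have fin_sym: "finite (set_pmf (sym_point x y))" for x y
    using finite_subset[OF set_pmf_sym_point_subset] by blast
  have E_R: "measure_pmf.expectation (R (a, b)) f = (1 - \<beta> a b) * sym_avg f a + \<beta> a b * sym_avg f b"
    if "(a, b) \<in> J" for a b f
    using \<beta>[OF that] by (simp add: R_def expectation_mixture fin_sym expectation_sym_point sym_avg_def
        prod.swap_def del: atLeastAtMost_iff)
  have mix: "measure_pmf.expectation Q f = (\<Sum>j\<in>J. c j * measure_pmf.expectation (R j) f)" for f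
    unfolding E_avg decomp by (intro sum.cong refl) (auto simp: E_R)
  have R_family: "R j \<in> two_point_family t" if "j \<in> J" for j
  proof -
    obtain a b where j: "j = (a, b)" and ab: "a \<in> U" "b \<in> U" "m a \<le> t" "t < m b"
      using \<open>j \<in> J\<close> by (auto simp: J_def)
    have "fst a \<in> {0..1}" "snd a \<in> {0..1}" "fst b \<in> {0..1}" "snd b \<in> {0..1}"
      using ab U by auto
    moreover from this have "0 \<le> m a" "m b \<le> 1"
      by (auto simp: m_def)
    moreover have "\<beta> a b = 0 \<or> \<beta> a b = (t - m a) / (m b - m a) \<and> \<beta> a b > 0"
      using ab by (auto simp: \<beta>_def zero_less_divide_iff)
    ultimately show ?thesis
      using ab unfolding two_point_family_def Let_def j R_def m_def prod.case mem_Collect_eq by blast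
  qed
  have R_unit: "map_pmf fst (R j) \<in> fin_dists" if "j \<in> J" for j
  proof -
    obtain a b where j: "j = (a, b)" "a \<in> U" "b \<in> U"
      using \<open>j \<in> J\<close> by (auto simp: J_def)
    then have "set_pmf (R j) \<subseteq> {a, prod.swap a, b, prod.swap b}"
      using set_pmf_two_point_subset[of "\<beta> a b" "fst a" "snd a" "fst b" "snd b"]
      by (simp add: R_def prod.swap_def)
    moreover have "{a, prod.swap a, b, prod.swap b} \<subseteq> {0..1} \<times> {0..1}"
      using j U by auto
    ultimately show ?thesis
      unfolding fin_dists_def by (auto intro: finite_subset)
  qed
  have "(\<Sum>j\<in>J. c j * union_entropy (map_pmf fst (R j))) \<le> union_entropy (map_pmf fst Q)"
  proof (rule union_entropy_concave[OF finJ c])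
    show "map_pmf fst Q \<in> fin_dists"
      using fin unit by (auto simp: fin_dists_def)
    fix j assume "j \<in> J"
    then obtain a b where j: "j = (a, b)" "(a, b) \<in> J"
      by (cases j) auto
    have "measure_pmf.expectation (map_pmf fst (R j)) (\<lambda>p. 1 - p) =
        1 - ((1 - \<beta> a b) * m a + \<beta> a b * m b)"
      using j E_R[OF j(2), of "\<lambda>u. 1 - fst u"] by (simp add: sym_avg_def m_def field_simps)
    also have "\<dots> = measure_pmf.expectation (map_pmf fst Q) (\<lambda>p. 1 - p)"
      using \<beta>(2)[OF j(2)] mean fin by (simp add: integrable_measure_pmf_finite)
    finally show "measure_pmf.expectation (map_pmf fst (R j)) (\<lambda>p. 1 - p) =
        measure_pmf.expectation (map_pmf fst Q) (\<lambda>p. 1 - p)" .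
  qed (use mix R_unit in auto)
  then have U_ge: "(1 - \<alpha>) * (\<Sum>j\<in>J. c j * union_entropy (map_pmf fst (R j))) \<le>
      (1 - \<alpha>) * union_entropy (map_pmf fst Q)"
    using \<alpha> by (intro mult_left_mono) auto
  have "v * measure_pmf.expectation (map_pmf fst Q) bin_entropy =
      (\<Sum>j\<in>J. c j * (v * measure_pmf.expectation (map_pmf fst (R j)) bin_entropy))"
    by (simp add: mix sum_distrib_left mult_ac)
  also have "\<dots> \<le> (\<Sum>j\<in>J. c j * g_fun (R j) \<alpha>)"
    by (intro sum_mono mult_left_mono ge R_family c)
  also have "\<dots> = (1 - \<alpha>) * (\<Sum>j\<in>J. c j * union_entropy (map_pmf fst (R j)))
      + \<alpha> * measure_pmf.expectation Q (\<lambda>(p, q). bin_entropy (phi 1 p q))"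
    unfolding g_fun_alt mix sum_distrib_left sum.distrib[symmetric]
    by (intro sum.cong refl) (simp add: algebra_simps)
  also have "\<dots> \<le> g_fun Q \<alpha>"
    using U_ge by (simp add: g_fun_alt)
  finally show ?thesis .
qed

lemma union_entropy_iterated:
  assumes "finite (set_pmf P)"
  shows "union_entropy P = measure_pmf.expectation P
    (\<lambda>p. measure_pmf.expectation P (\<lambda>q. bin_entropy (p + q - p * q)))"
  unfolding union_entropy_def expectation_pair_pmf_finite[OF assms assms] expectation_pmf_finite[OF assms]
  by (simp add: sum_distrib_left mult.assoc)

text \<open>Only pairs without the extra atom contribute, because \<open>p + q - p q = 1\<close> as soon as \<open>p = 1\<close> or
  \<open>q = 1\<close>.\<close>

lemma union_entropy_mixture_1:
  assumes "finite (set_pmf P)" "s \<in> {0..1}"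
  shows "union_entropy (mixture s P (return_pmf 1)) = (1 - s)\<^sup>2 * union_entropy P"
proof -
  have "finite (set_pmf (mixture s P (return_pmf 1)))"
    using finite_subset[OF set_pmf_mixture_subset[of s P "return_pmf 1"]] assms(1) by simp
  then show ?thesis
    using assms by (simp add: union_entropy_iterated expectation_mixture power2_eq_square)
qed

text \<open>Moving mass \<open>s\<close> to \<open>(1, 1)\<close> raises the mean to exactly \<open>t\<close>. It multiplies the entropy and the
  coupled term by \<open>1 - s\<close>, but the independent term by \<open>(1 - s)\<^sup>2\<close>, so the ratio to be bounded can
  only drop and the case of mean \<open>t\<close> applies.\<close>

lemma g_fun_ge_of_mean_le:
  assumes \<alpha>: "\<alpha> \<in> {0..1}" and "t < 1"
    and fin: "finite (set_pmf Q)" and unit: "set_pmf Q \<subseteq> {0..1} \<times> {0..1}"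
    and sym: "map_pmf prod.swap Q = Q" and mean: "measure_pmf.expectation Q fst \<le> t"
    and ge: "\<And>R. R \<in> two_point_family t \<Longrightarrow>
      v * measure_pmf.expectation (map_pmf fst R) bin_entropy \<le> g_fun R \<alpha>"
  shows "v * measure_pmf.expectation (map_pmf fst Q) bin_entropy \<le> g_fun Q \<alpha>"
proof -
  define \<mu> where "\<mu> = measure_pmf.expectation Q fst"
  define s where "s = (t - \<mu>) / (1 - \<mu>)"
  define Q' where "Q' = mixture s Q (return_pmf (1, 1))"
  define P where "P = map_pmf fst Q"
  define K where "K = measure_pmf.expectation Q (\<lambda>(p, q). bin_entropy (phi 1 p q))"
  have "\<mu> \<le> t"
    using mean by (simp add: \<mu>_def)
  have s: "0 \<le> s" "s < 1" "(1 - s) * \<mu> + s = t"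
  proof -
    have "\<mu> < 1" "s * (1 - \<mu>) = t - \<mu>"
      using \<open>\<mu> \<le> t\<close> \<open>t < 1\<close> by (auto simp: s_def)
    then show "(1 - s) * \<mu> + s = t"
      by (simp add: algebra_simps)
    show "0 \<le> s" "s < 1"
      using \<open>\<mu> < 1\<close> \<open>\<mu> \<le> t\<close> \<open>t < 1\<close> by (auto simp: s_def)
  qed
  have E': "measure_pmf.expectation Q' f = (1 - s) * measure_pmf.expectation Q f + s * f (1, 1)"
    for f :: "_ \<Rightarrow> real"
    using s fin by (simp add: Q'_def expectation_mixture)
  have fst': "map_pmf fst Q' = mixture s P (return_pmf 1)"
    by (simp add: Q'_def P_def map_pmf_mixture)
  have sub: "set_pmf Q' \<subseteq> insert (1, 1) (set_pmf Q)"
    using set_pmf_mixture_subset[of s Q "return_pmf (1, 1)"] by (auto simp: Q'_def)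
  have "v * measure_pmf.expectation (map_pmf fst Q') bin_entropy \<le> g_fun Q' \<alpha>"
  proof (rule g_fun_ge_of_mean_eq[OF \<alpha> \<open>t < 1\<close> _ _ _ _ ge])
    show "finite (set_pmf Q')" "set_pmf Q' \<subseteq> {0..1} \<times> {0..1}"
      using sub fin unit by (auto intro: finite_subset)
    show "map_pmf prod.swap Q' = Q'"
      by (simp add: Q'_def map_pmf_mixture sym)
    show "measure_pmf.expectation Q' fst = t"
      using s by (simp add: E' \<mu>_def)
  qed
  also have "g_fun Q' \<alpha> = (1 - \<alpha>) * ((1 - s)\<^sup>2 * union_entropy P) + \<alpha> * ((1 - s) * K)"
    using s fin by (simp add: g_fun_alt fst' union_entropy_mixture_1 P_def E' phi_1_1 K_def)
  also have "\<dots> \<le> (1 - \<alpha>) * ((1 - s) * union_entropy P) + \<alpha> * ((1 - s) * K)"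
  proof -
    have "union_entropy P \<ge> 0"
      using unit by (intro union_entropy_nonneg) (auto simp: P_def)
    then show ?thesis
      using s \<alpha> by (intro add_right_mono mult_left_mono mult_right_mono)
        (auto simp: power2_eq_square mult_left_le)
  qed
  also have "\<dots> = (1 - s) * g_fun Q \<alpha>"
    by (simp add: g_fun_alt P_def K_def algebra_simps)
  also have "v * measure_pmf.expectation (map_pmf fst Q') bin_entropy =
      (1 - s) * (v * measure_pmf.expectation (map_pmf fst Q) bin_entropy)"
    by (simp add: E')
  finally show ?thesis
    using s by simp
qed

theorem proposition1:
  fixes t :: real
  assumes "t \<in> {0<..<1/2}"
  shows "Gam t \<ge> Gam_hat t"
  unfolding Gam_hat_def
proof (rule SUP_least)
  fix \<alpha> :: real assume \<alpha>: "\<alpha> \<in> {0..1}"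
  define I where "I = (INF Q \<in> {Q \<in> two_point_family t.
      measure_pmf.expectation (map_pmf fst Q) bin_entropy > 0}.
    ereal (g_fun Q \<alpha> / measure_pmf.expectation (map_pmf fst Q) bin_entropy))"
  have real_le: "ereal v \<le> Gam t" if "ereal v \<le> I" for v
  proof (rule Gam_ge_if_couplings_ge[OF \<alpha>])
    fix P Q
    assume P: "P \<in> fin_dists" "measure_pmf.expectation P bin_entropy > 0"
      "measure_pmf.expectation P (\<lambda>p. p) \<le> t" and Q: "Q \<in> sym_couplings P"
    then have marg: "map_pmf fst Q = P" "map_pmf snd Q = P"
      by (auto simp: sym_couplings_def)
    have sub: "set_pmf Q \<subseteq> set_pmf P \<times> set_pmf P"
      using set_pmf_subset_marginals[of Q] by (simp only: marg)
    have "v * measure_pmf.expectation (map_pmf fst Q) bin_entropy \<le> g_fun Q \<alpha>"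
    proof (rule g_fun_ge_of_mean_le[OF \<alpha>])
      show "t < 1"
        using assms by simp
      show "finite (set_pmf Q)" "set_pmf Q \<subseteq> {0..1} \<times> {0..1}"
        using sub P(1) by (auto simp: fin_dists_def intro: finite_subset)
      show "map_pmf prod.swap Q = Q"
      proof (rule pmf_eqI, clarify)
        fix x y
        show "pmf (map_pmf prod.swap Q) (x, y) = pmf Q (x, y)"
          using Q pmf_map_inj'[of prod.swap Q "(y, x)"] by (simp add: sym_couplings_def)
      qed
      show "measure_pmf.expectation Q fst \<le> t"
        using P(3) by (simp add: marg(1)[symmetric])
      fix R assume "R \<in> two_point_family t"
      then show "v * measure_pmf.expectation (map_pmf fst R) bin_entropy \<le> g_fun R \<alpha>"
      proof (rule two_point_family_g_fun_ge[OF \<alpha>])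
        fix Q assume "Q \<in> two_point_family t" "measure_pmf.expectation (map_pmf fst Q) bin_entropy > 0"
        then have "I \<le> ereal (g_fun Q \<alpha> / measure_pmf.expectation (map_pmf fst Q) bin_entropy)"
          unfolding I_def by (intro INF_lower) simp
        from order_trans[OF that this]
        show "v \<le> g_fun Q \<alpha> / measure_pmf.expectation (map_pmf fst Q) bin_entropy"
          by simp
      qed
    qed
    then show "v \<le> g_fun Q \<alpha> / measure_pmf.expectation P bin_entropy"
      using P(2) by (simp only: marg pos_le_divide_eq)
  qed
  show "I \<le> Gam t"
  proof (cases I)
    case (real v)
    then show ?thesis
      using real_le by simp
  next
    case PInf
    then show ?thesis
      using real_le by (simp add: ereal_top)
  qed simp
qed

end
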